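(* Let $\varepsilon\in(0,1)$ and let $G$ be a graph on $[n]$ with average degree $\bar d$ and maximum degree $\Delta\le\frac{\varepsilon^2 n}{3(\bar d+1)^3}$, presented as an insertion-only random-order vertex-arrival stream. The algorithm CWEI$_3$ (described in the context) outputs, with probability at least $19/30$, a value $\widehat\lambda$ with $(1-\varepsilon)\lambda\le\widehat\lambda\le(1+\varepsilon)\lambda$, where $\lambda=\sum_v\frac{1}{d(v)+1}$ is the Caro–Wei bound of $G$, and uses $\mathcal O(\log(\bar d\,\varepsilon^{-2}))$ bits of space.
   Context: Graphs are simple, undirected, on vertex set $[n]$, $n$ known; $d(v)$ is the degree, $\bar d$ the average degree, $\Delta$ the maximum degree. A vertex-arrival stream is a sequence of pairs $(u_i,A_i)$, one per vertex, where $A_i$ is the set of vertices $u_j$ with $j<i$ that are adjacent to $u_i$. It is random-order if the order in which the vertices arrive is a uniformly random permutation. Algorithm CWEI$_3$: set $p=\frac{4(\bar d+1)}{\varepsilon^2 n}$ and a counter $c=0$; when a vertex $u_i$ arrives with $A_i=\emptyset$, increment $c$ with probability $p$ (independently); abort (fail) if $c>10pn$; output $\widehat\lambda=c/p$.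
   Formalization: The sampling probability p is capped at 1, since the stated p can exceed 1; the space bound is O(1+log((d̄+1)/ε²)) in general, and literally O(log(d̄ε⁻²)) when d̄≥1 and d̄/ε²≥2, because the literal bound fails for small d̄ or log near 0. *)

theory Defs
  imports "HOL-Probability.Probability" "HOL-Combinatorics.Multiset_Permutations"
begin

section \<open>Simple graphs on the vertex set \<open>{1..n}\<close>\<close>

definition simple_graph :: "nat \<Rightarrow> nat set set \<Rightarrow> bool" where
  "simple_graph n E \<longleftrightarrow> (\<forall>e\<in>E. e \<subseteq> {1..n} \<and> card e = 2)"

definition degree :: "nat set set \<Rightarrow> nat \<Rightarrow> nat" where
  "degree E v = card {u. {u, v} \<in> E}"

definition avg_degree :: "nat \<Rightarrow> nat set set \<Rightarrow> real" where
  "avg_degree n E = (\<Sum>v\<in>{1..n}. real (degree E v)) / real n"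

definition max_degree :: "nat \<Rightarrow> nat set set \<Rightarrow> nat" where
  "max_degree n E = Max (degree E ` {1..n})"

definition caro_wei :: "nat \<Rightarrow> nat set set \<Rightarrow> real" where
  "caro_wei n E = (\<Sum>v\<in>{1..n}. 1 / (real (degree E v) + 1))"


section \<open>Vertex-arrival streams\<close>

type_synonym arrival = "nat \<times> nat set"

definition arrival_stream :: "nat set set \<Rightarrow> nat list \<Rightarrow> arrival list" where
  "arrival_stream E us =
     map (\<lambda>i. (us ! i, {us ! j | j. j < i \<and> {us ! i, us ! j} \<in> E})) [0..<length us]"

definition random_order_stream :: "nat \<Rightarrow> nat set set \<Rightarrow> arrival list pmf" where
  "random_order_stream n E =
     map_pmf (arrival_stream E) (pmf_of_set (permutations_of_set {1..n}))"


section \<open>Randomised streaming algorithms\<close>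

text \<open>
  The state is the entire working memory carried from one stream item to the next.
  Every step draws fresh randomness, independent of all earlier steps.
\<close>

record ('i, 's, 'o) streaming_alg =
  init :: 's
  step :: "'i \<Rightarrow> 's \<Rightarrow> 's pmf"
  result :: "'s \<Rightarrow> 'o"

primrec run_from :: "('i, 's, 'o) streaming_alg \<Rightarrow> 's \<Rightarrow> 'i list \<Rightarrow> 's pmf" where
  "run_from A s [] = return_pmf s"
| "run_from A s (x # xs) = bind_pmf (step A x s) (\<lambda>s'. run_from A s' xs)"

definition run :: "('i, 's, 'o) streaming_alg \<Rightarrow> 'i list \<Rightarrow> 'o pmf" where
  "run A xs = map_pmf (result A) (run_from A (init A) xs)"

text \<open>
  Space is worst case over all inputs and all coin outcomes: \<open>b\<close> bits suffice if the
  memory states that can ever occur can be stored faithfully in \<open>b\<close>-bit words.  The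
  parameters of an algorithm are part of its program and are not charged.
\<close>

definition reachable :: "('i, 's, 'o) streaming_alg \<Rightarrow> 's set" where
  "reachable A = (\<Union>xs. set_pmf (run_from A (init A) xs))"

definition uses_bits :: "('i, 's, 'o) streaming_alg \<Rightarrow> nat \<Rightarrow> bool" where
  "uses_bits A b \<longleftrightarrow>
     (\<exists>enc :: 's \<Rightarrow> bool list. inj_on enc (reachable A) \<and>
        (\<forall>s\<in>reachable A. length (enc s) = b))"


section \<open>The algorithm\<close>

text \<open>
  The sampling rate is \<open>4 (d + 1) / (\<epsilon>\<^sup>2 n)\<close>, truncated at \<open>1\<close> so that it is a
  probability also when \<open>n\<close> is small compared with \<open>(d + 1) / \<epsilon>\<^sup>2\<close>.  Without the truncation,
  counting every vertex and then dividing by a rate above \<open>1\<close> would underestimate;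
  for \<open>n = 1\<close>, \<open>d = 0\<close> the output would be \<open>\<epsilon>\<^sup>2 / 4\<close> instead of \<open>1\<close>.
\<close>

definition cwei3_rate :: "nat \<Rightarrow> real \<Rightarrow> real \<Rightarrow> real" where
  "cwei3_rate n d \<epsilon> = min 1 (4 * (d + 1) / (\<epsilon>\<^sup>2 * real n))"

text \<open>The state \<open>None\<close> means that the algorithm has aborted.\<close>

definition cwei3 :: "nat \<Rightarrow> real \<Rightarrow> real \<Rightarrow> (arrival, nat option, real option) streaming_alg" where
  "cwei3 n d \<epsilon> = (let p = cwei3_rate n d \<epsilon> in
     \<lparr> init = Some 0,
       step = (\<lambda>(u, A) s. case s of
           None \<Rightarrow> return_pmf None
         | Some c \<Rightarrow>
             if A = {} then
               map_pmf (\<lambda>coin. let c' = (if coin then c + 1 else c) in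
                          if real c' > 10 * p * real n then None else Some c')
                 (bernoulli_pmf p)
             else return_pmf (Some c)),
       result = map_option (\<lambda>c. real c / p) \<rparr>)"

end

(*
  Call a vertex early if it precedes all its neighbours in the random order. A vertex v is early
  with probability 1 / (d(v) + 1), so the number K of early vertices has mean lambda. If the
  closed neighbourhoods of u and v are disjoint, transposing within them shows that the two
  events are independent; adjacent vertices are never both early. The remaining pairs (u, v),
  with u = v allowed, have a common neighbour, and there are at most
  sum_w d(w)^2 <= Delta n d of them, where d is the average degree. Hence
  Var K <= Delta n d / 4 <= eps^2 (n / (d + 1))^2 / 12 <= eps^2 lambda^2 / 12,
  the last step by the convexity bound lambda >= n / (d + 1).

  Given K, the counter is binomial, which adds lambda (1 - p) / p <= eps^2 lambda^2 / 4 to the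
  variance of the estimate. Chebyshev's inequality bounds the failure probability by
  1/4 + 1/12 = 1/3 < 11/30.
*)

theory Submission
  imports Defs
begin

section \<open>Uniformly random orders\<close>

text \<open>The map \<open>g\<close> preserves \<open>p\<close> and carries the event
  \<open>f x = i\<close> to the event \<open>f x = j\<close>, so all values in \<open>I\<close> have
  the same probability. These probabilities sum to 1 over \<open>I\<close>.\<close>

lemma prob_eq_if_symmetric:
  fixes p :: "'a pmf" and f :: "'a \<Rightarrow> 'b"
  assumes fin: "finite I" and range: "\<And>x. x \<in> set_pmf p \<Longrightarrow> f x \<in> I"
    and sym: "\<And>i j. i \<in> I \<Longrightarrow> j \<in> I \<Longrightarrow>
      \<exists>g. map_pmf g p = p \<and> (\<forall>x\<in>set_pmf p. f (g x) = j \<longleftrightarrow> f x = i)"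
    and i: "i \<in> I"
  shows "measure_pmf.prob p {x. f x = i} = 1 / real (card I)"
proof -
  have eq: "pmf (map_pmf f p) j = pmf (map_pmf f p) i" if j: "j \<in> I" for j
  proof -
    obtain g where g: "map_pmf g p = p" "\<And>x. x \<in> set_pmf p \<Longrightarrow> f (g x) = j \<longleftrightarrow> f x = i"
      using sym[OF i j] by blast
    have "pmf (map_pmf f p) j = pmf (map_pmf f (map_pmf g p)) j"
      by (simp only: g(1))
    also have "\<dots> = measure_pmf.prob p {x. f (g x) = j}"
      by (simp add: pmf_map pmf.map_comp vimage_def)
    also have "\<dots> = measure_pmf.prob p {x. f x = i}"
      by (rule measure_pmf.finite_measure_eq_AE) (auto simp: AE_measure_pmf_iff g(2))
    also have "\<dots> = pmf (map_pmf f p) i"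
      by (simp add: pmf_map vimage_def)
    finally show ?thesis .
  qed
  have "1 = (\<Sum>j\<in>I. pmf (map_pmf f p) j)"
    by (rule sum_pmf_eq_1[symmetric]) (use fin range in auto)
  also have "\<dots> = real (card I) * pmf (map_pmf f p) i"
    by (simp add: eq)
  finally show ?thesis
    by (cases "card I = 0") (simp_all add: field_simps pmf_map vimage_def)
qed

definition random_order :: "'a set \<Rightarrow> 'a list pmf" where
  "random_order S = pmf_of_set (permutations_of_set S)"

lemma set_pmf_random_order:
  "finite S \<Longrightarrow> set_pmf (random_order S) = permutations_of_set S"
  by (simp add: random_order_def)

lemma integrable_random_order [simp]:
  "finite S \<Longrightarrow> integrable (measure_pmf (random_order S)) (f :: 'a list \<Rightarrow> real)"
  by (rule integrable_measure_pmf_finite) (simp add: set_pmf_random_order)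

lemma map_random_order:
  assumes "finite S" "\<tau> permutes S"
  shows "map_pmf (map \<tau>) (random_order S) = random_order S"
proof -
  have "bij_betw (map \<tau>) (permutations_of_set S) (permutations_of_set S)"
    unfolding bij_betw_def
  proof
    show "inj_on (map \<tau>) (permutations_of_set S)"
      using permutes_inj[OF assms(2)] by (meson inj_mapI inj_on_subset subset_UNIV)
  qed (rule permutations_of_set_image_permutes[OF assms(2)])
  thus ?thesis
    unfolding random_order_def by (rule map_pmf_of_set_bij_betw) (use assms in auto)
qed

text \<open>If no element of \<open>A\<close> occurs in \<open>us\<close>, this is the unspecified
  \<open>hd []\<close>; hence the assumption \<open>set us \<inter> A \<noteq> {}\<close> in the
  facts below.\<close>

definition first_in :: "'a set \<Rightarrow> 'a list \<Rightarrow> 'a" where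
  "first_in A us = hd (filter (\<lambda>x. x \<in> A) us)"

lemma first_in_mem:
  assumes "set us \<inter> A \<noteq> {}"
  shows "first_in A us \<in> A"
proof -
  have "filter (\<lambda>x. x \<in> A) us \<noteq> []"
    using assms by (auto simp: filter_empty_conv)
  thus ?thesis
    unfolding first_in_def using hd_in_set by force
qed

text \<open>A relabelling that maps neither into nor out of \<open>A\<close> commutes with filtering
  by \<open>A\<close>.\<close>

lemma first_in_map:
  assumes "set us \<inter> A \<noteq> {}" "\<And>x. \<tau> x \<in> A \<longleftrightarrow> x \<in> A"
  shows "first_in A (map \<tau> us) = \<tau> (first_in A us)"
proof -
  have "filter (\<lambda>x. x \<in> A) us \<noteq> []"
    using assms(1) by (auto simp: filter_empty_conv)
  moreover have "filter (\<lambda>x. x \<in> A) (map \<tau> us) = map \<tau> (filter (\<lambda>x. x \<in> A) us)"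
    by (simp add: filter_map o_def assms(2))
  ultimately show ?thesis
    by (simp add: first_in_def hd_map)
qed

text \<open>Filtering by \<open>A \<inter> B\<close> is filtering by \<open>A\<close> and then by
  \<open>B\<close>; the second filter keeps the head. This later rules out that two adjacent
  vertices are both early.\<close>

lemma first_in_Int:
  assumes "set us \<inter> A \<noteq> {}" "first_in A us \<in> B"
  shows "first_in (A \<inter> B) us = first_in A us"
proof -
  obtain y ys where y: "filter (\<lambda>x. x \<in> A) us = y # ys"
    using assms(1) by (cases "filter (\<lambda>x. x \<in> A) us") (auto simp: filter_empty_conv)
  have "filter (\<lambda>x. x \<in> A \<inter> B) us = filter (\<lambda>x. x \<in> B) (filter (\<lambda>x. x \<in> A) us)"
    by (simp add: conj_commute)
  thus ?thesis
    using assms(2) y by (simp add: first_in_def)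
qed

text \<open>Transposing two elements of \<open>A\<close> preserves both \<open>A\<close> and the law
  of the order, and it exchanges the events that one or the other comes first in
  \<open>A\<close>.\<close>

lemma prob_first_in:
  assumes S: "finite S" and A: "A \<subseteq> S" and a: "a \<in> A"
  shows "measure_pmf.prob (random_order S) {us. first_in A us = a} = 1 / real (card A)"
proof (rule prob_eq_if_symmetric)
  have ne: "set us \<inter> A \<noteq> {}" if "us \<in> set_pmf (random_order S)" for us
    using that A a by (auto simp: set_pmf_random_order S dest: permutations_of_setD)
  show "first_in A us \<in> A" if "us \<in> set_pmf (random_order S)" for us
    by (rule first_in_mem) (rule ne[OF that])
  show "\<exists>g. map_pmf g (random_order S) = random_order S \<and>
      (\<forall>us\<in>set_pmf (random_order S). first_in A (g us) = j \<longleftrightarrow> first_in A us = i)"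
    if i: "i \<in> A" and j: "j \<in> A" for i j
  proof (intro exI conjI ballI)
    let ?\<tau> = "Transposition.transpose i j"
    show "map_pmf (map ?\<tau>) (random_order S) = random_order S"
      by (rule map_random_order) (use S A i j in \<open>auto intro: permutes_swap_id\<close>)
    fix us assume "us \<in> set_pmf (random_order S)"
    moreover have "?\<tau> x \<in> A \<longleftrightarrow> x \<in> A" for x
      using i j by (auto simp: Transposition.transpose_def)
    ultimately have "first_in A (map ?\<tau> us) = ?\<tau> (first_in A us)"
      by (intro first_in_map ne)
    thus "first_in A (map ?\<tau> us) = j \<longleftrightarrow> first_in A us = i"
      by (auto simp: transpose_eq_iff)
  qed
  show "finite A"
    using S A by (rule finite_subset[rotated])
qed (fact a)

text \<open>Since \<open>A\<close> and \<open>B\<close> are disjoint, a transposition inside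
  \<open>A\<close> and one inside \<open>B\<close> act independently on the two first elements.
  Their composition moves any pair in \<open>A \<times> B\<close> to any other, so the pair is
  uniform there.\<close>

lemma prob_first_in_disjoint:
  assumes S: "finite S" and A: "A \<subseteq> S" and B: "B \<subseteq> S" and AB: "A \<inter> B = {}"
    and a: "a \<in> A" and b: "b \<in> B"
  shows "measure_pmf.prob (random_order S) {us. first_in A us = a \<and> first_in B us = b}
    = 1 / (real (card A) * real (card B))"
proof -
  let ?f = "\<lambda>us. (first_in A us, first_in B us)"
  have neA: "set us \<inter> A \<noteq> {}" and neB: "set us \<inter> B \<noteq> {}"
    if "us \<in> set_pmf (random_order S)" for us
    using that A a B b by (auto simp: set_pmf_random_order S dest: permutations_of_setD)
  have "measure_pmf.prob (random_order S) {us. ?f us = (a, b)} = 1 / real (card (A \<times> B))"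
  proof (rule prob_eq_if_symmetric)
    show "?f us \<in> A \<times> B" if "us \<in> set_pmf (random_order S)" for us
      using first_in_mem[OF neA[OF that]] first_in_mem[OF neB[OF that]] by simp
    show "\<exists>g. map_pmf g (random_order S) = random_order S \<and>
        (\<forall>us\<in>set_pmf (random_order S). ?f (g us) = j \<longleftrightarrow> ?f us = i)"
      if ij: "i \<in> A \<times> B" "j \<in> A \<times> B" for i j
    proof -
      obtain u v x y where i: "i = (u, v)" "u \<in> A" "v \<in> B" and j: "j = (x, y)" "x \<in> A" "y \<in> B"
        using ij by blast
      let ?\<tau> = "Transposition.transpose u x \<circ> Transposition.transpose v y"
      have "?\<tau> permutes S"
        using i j A B by (intro permutes_compose permutes_swap_id) auto
      moreover have "?f (map ?\<tau> us) = j \<longleftrightarrow> ?f us = i"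
        if us: "us \<in> set_pmf (random_order S)" for us
      proof -
        have notin: "z \<notin> B" if "z \<in> A" for z
          using AB that by blast
        have "?\<tau> z \<in> A \<longleftrightarrow> z \<in> A" for z
          using i j notin by (auto simp: Transposition.transpose_def)
        hence "first_in A (map ?\<tau> us) = ?\<tau> (first_in A us)"
          by (intro first_in_map neA us)
        \<comment> \<open>The other transposition moves only elements of \<open>B\<close>, so it
          fixes the first element of \<open>A\<close>.\<close>
        also have "\<dots> = Transposition.transpose u x (first_in A us)"
          using first_in_mem[OF neA[OF us]] i j notin by (auto simp: Transposition.transpose_def)
        finally have 1: "first_in A (map ?\<tau> us) = x \<longleftrightarrow> first_in A us = u"
          by (auto simp: transpose_eq_iff)
        have "?\<tau> z \<in> B \<longleftrightarrow> z \<in> B" for z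
          using i j notin by (auto simp: Transposition.transpose_def)
        hence "first_in B (map ?\<tau> us) = ?\<tau> (first_in B us)"
          by (intro first_in_map neB us)
        also have "\<dots> = Transposition.transpose v y (first_in B us)"
          using first_in_mem[OF neB[OF us]] i j notin by (auto simp: Transposition.transpose_def)
        finally have "first_in B (map ?\<tau> us) = y \<longleftrightarrow> first_in B us = v"
          by (auto simp: transpose_eq_iff)
        with 1 show ?thesis
          by (simp add: i j)
      qed
      ultimately show ?thesis
        using map_random_order[OF S] by blast
    qed
    show "finite (A \<times> B)"
      using S A B by (simp add: finite_subset)
  qed (use a b in auto)
  thus ?thesis
    by (simp add: card_cartesian_product)
qed

section \<open>The number of vertices that precede all their neighbours\<close>

definition closed_nbhd :: "nat set set \<Rightarrow> nat \<Rightarrow> nat set" where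
  "closed_nbhd E v = insert v {u. {u, v} \<in> E}"

text \<open>Phrased through the closed neighbourhood so that the symmetry results on
  \<open>first_in\<close> apply directly; \<open>early_count_eq_length\<close> links it to empty
  arrival sets.\<close>

definition is_early :: "nat set set \<Rightarrow> nat list \<Rightarrow> nat \<Rightarrow> bool" where
  "is_early E us v \<longleftrightarrow> first_in (closed_nbhd E v) us = v"

definition early_count :: "nat \<Rightarrow> nat set set \<Rightarrow> nat list \<Rightarrow> real" where
  "early_count n E us = (\<Sum>v\<in>{1..n}. of_bool (is_early E us v))"

context
  fixes n :: nat and E :: "nat set set"
  assumes E: "simple_graph n E"
begin

lemma edgeD: "{u, v} \<in> E \<Longrightarrow> u \<in> {1..n} \<and> v \<in> {1..n} \<and> u \<noteq> v"
  using E unfolding simple_graph_def by (cases "u = v") fastforce+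

lemma closed_nbhd_subset: "v \<in> {1..n} \<Longrightarrow> closed_nbhd E v \<subseteq> {1..n}"
  by (auto simp: closed_nbhd_def dest: edgeD)

lemma finite_nbhd: "finite {u. {u, v} \<in> E}"
  by (rule finite_subset[of _ "{1..n}"]) (auto dest: edgeD)

lemma card_closed_nbhd: "card (closed_nbhd E v) = degree E v + 1"
  using finite_nbhd[of v] edgeD[of v v] by (auto simp: closed_nbhd_def degree_def card_insert_if)

lemma degree_eq_sum: "real (degree E v) = (\<Sum>u\<in>{1..n}. of_bool ({u, v} \<in> E))"
proof -
  have "{u. {u, v} \<in> E} = {1..n} \<inter> {u. {u, v} \<in> E}"
    by (auto dest: edgeD)
  thus ?thesis
    by (simp add: degree_def sum_of_bool_eq)
qed

lemma prob_is_early: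
  assumes "v \<in> {1..n}"
  shows "measure_pmf.prob (random_order {1..n}) {us. is_early E us v} = 1 / (real (degree E v) + 1)"
  unfolding is_early_def
  by (subst prob_first_in[OF _ closed_nbhd_subset[OF assms]])
    (simp_all add: card_closed_nbhd add.commute, simp add: closed_nbhd_def)

text \<open>Adjacent \<open>u\<close> and \<open>v\<close> lie in both closed neighbourhoods. If
  both were early, each would be the first element of the intersection, but they are
  distinct.\<close>

lemma is_early_adjacent:
  assumes us: "us \<in> permutations_of_set {1..n}" and e: "{u, v} \<in> E"
    and "is_early E us u" "is_early E us v"
  shows False
proof -
  let ?A = "closed_nbhd E u" and ?B = "closed_nbhd E v"
  have mem: "u \<in> ?A" "v \<in> ?B" "u \<in> ?B" "v \<in> ?A"
    using e by (auto simp: closed_nbhd_def insert_commute)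
  have "u \<in> set us" "v \<in> set us"
    using edgeD[OF e] us by (auto dest: permutations_of_setD)
  hence "first_in (?A \<inter> ?B) us = u" "first_in (?B \<inter> ?A) us = v"
    using first_in_Int[of us ?A ?B] first_in_Int[of us ?B ?A] mem assms(3,4)
    by (auto simp: is_early_def)
  thus False
    using edgeD[OF e] by (simp add: Int_commute)
qed

text \<open>
  A crude bound on each covariance suffices: it is at most \<open>1/4\<close>, and it can be positive only
  when \<open>u\<close> and \<open>v\<close> have a common neighbour. For \<open>u = v\<close> this says that \<open>u\<close> is not isolated.
\<close>

lemma covariance_is_early:
  assumes u: "u \<in> {1..n}" and v: "v \<in> {1..n}"
  shows "measure_pmf.prob (random_order {1..n}) {us. is_early E us u \<and> is_early E us v}
      - 1 / (real (degree E u) + 1) * (1 / (real (degree E v) + 1))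
    \<le> (\<Sum>w\<in>{1..n}. of_bool ({u, w} \<in> E) * of_bool ({v, w} \<in> E)) / 4"
    (is "?P - ?x * ?y \<le> ?k / 4")
proof -
  let ?R = "random_order {1..n}"
  have k0: "?k \<ge> 0"
    by (rule sum_nonneg) auto
  have x: "0 \<le> ?x" "?x \<le> 1" and y: "0 \<le> ?y" "?y \<le> 1"
    by (simp_all add: field_simps)
  have quarter_bound: "z - z * z \<le> 1 / 4" for z :: real
    using zero_le_power2[of "z - 1 / 2"] by (simp add: power2_eq_square algebra_simps)
  have "?P \<le> ?x" "?P \<le> ?y"
    unfolding prob_is_early[OF u, symmetric] prob_is_early[OF v, symmetric]
    by (auto intro!: measure_pmf.finite_measure_mono)
  \<comment> \<open>\<open>?P\<close> is at most the smaller of \<open>?x\<close> and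
    \<open>?y\<close>, and \<open>?x * ?y\<close> is at least the square of that smaller value
    \<open>z\<close>. This leaves \<open>z - z * z\<close>.\<close>
  have quarter: "?P - ?x * ?y \<le> 1 / 4"
  proof (cases "?x \<le> ?y")
    case True
    have "?P - ?x * ?y \<le> ?x - ?x * ?x"
      using \<open>?P \<le> ?x\<close> mult_left_mono[OF True x(1)] by linarith
    also have "\<dots> \<le> 1 / 4"
      using quarter_bound[of ?x] .
    finally show ?thesis .
  next
    case False
    have "?P - ?x * ?y \<le> ?y - ?y * ?y"
      using \<open>?P \<le> ?y\<close> mult_right_mono[of ?y ?x ?y] y False by linarith
    also have "\<dots> \<le> 1 / 4"
      using quarter_bound[of ?y] .
    finally show ?thesis .
  qed
  show ?thesis
  proof (cases "\<exists>w. {u, w} \<in> E \<and> {v, w} \<in> E")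
    case True
    then obtain w where w: "{u, w} \<in> E" "{v, w} \<in> E" by blast
    \<comment> \<open>A single common neighbour already contributes 1 to the count
      \<open>?k\<close>.\<close>
    have "(1::real) = (\<Sum>w\<in>{w}. of_bool ({u, w} \<in> E) * of_bool ({v, w} \<in> E))"
      using w by simp
    also have "\<dots> \<le> ?k"
      by (rule sum_mono2) (use edgeD[OF w(1)] in auto)
    finally show ?thesis
      using quarter by simp
  next
    case no_common: False
    have "?P - ?x * ?y \<le> 0"
    proof (cases "u = v")
      case True
      \<comment> \<open>For \<open>u = v\<close> every neighbour would be a common one. So
        \<open>u\<close> is isolated, hence always early, and the covariance vanishes.\<close>
      have "{w. {w, u} \<in> E} = {}"
        using no_common True by (auto simp: insert_commute)
      hence "degree E u = 0"
        unfolding degree_def by simp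
      with True show ?thesis by simp
    next
      case False
      show ?thesis
      proof (cases "{u, v} \<in> E")
        case True
        have "?P = measure_pmf.prob ?R {}"
          by (rule measure_pmf.finite_measure_eq_AE)
            (use is_early_adjacent[OF _ True] in \<open>auto simp: AE_measure_pmf_iff set_pmf_random_order\<close>)
        thus ?thesis
          using mult_nonneg_nonneg[OF x(1) y(1)] by simp
      next
        case nonadj: False
        \<comment> \<open>With no edge between them and no common neighbour, the two events depend
          on disjoint sets, so they are independent.\<close>
        have disj: "closed_nbhd E u \<inter> closed_nbhd E v = {}"
          using no_common nonadj False by (auto simp: closed_nbhd_def insert_commute)
        show ?thesis
          unfolding is_early_def
          by (subst prob_first_in_disjoint[OF _ closed_nbhd_subset[OF u] closed_nbhd_subset[OF v] disj])
            (simp_all add: card_closed_nbhd add.commute, simp_all add: closed_nbhd_def)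
      qed
    qed
    thus ?thesis
      using k0 by linarith
  qed
qed

lemma expectation_is_early:
  assumes "v \<in> {1..n}"
  shows "measure_pmf.expectation (random_order {1..n}) (\<lambda>us. of_bool (is_early E us v))
    = 1 / (real (degree E v) + 1)"
proof -
  have "(\<lambda>us. of_bool (is_early E us v) :: real) = indicator {us. is_early E us v}"
    by (auto simp: indicator_def)
  thus ?thesis
    using prob_is_early[OF assms] by simp
qed

lemma expectation_early_count:
  "measure_pmf.expectation (random_order {1..n}) (early_count n E) = caro_wei n E"
  unfolding early_count_def caro_wei_def
  by (subst Bochner_Integration.integral_sum)
    (simp_all add: expectation_is_early del: One_nat_def)

text \<open>The square expands into covariances, each at most a quarter of the number of common
  neighbours. Grouped by the common neighbour \<open>w\<close>, the ordered pairs number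
  \<open>degree E w\<close> squared, and one of the two factors is bounded by the maximum
  degree.\<close>

lemma early_count_variance:
  "measure_pmf.expectation (random_order {1..n}) (\<lambda>us. (early_count n E us - caro_wei n E)\<^sup>2)
    \<le> real (max_degree n E) * (\<Sum>v\<in>{1..n}. real (degree E v)) / 4"
proof -
  let ?R = "random_order {1..n}"
  let ?q = "\<lambda>v. 1 / (real (degree E v) + 1)"
  let ?X = "\<lambda>us v. of_bool (is_early E us v) :: real"
  have cov: "measure_pmf.expectation ?R (\<lambda>us. (?X us u - ?q u) * (?X us v - ?q v))
    \<le> (\<Sum>w\<in>{1..n}. of_bool ({u, w} \<in> E) * of_bool ({v, w} \<in> E)) / 4"
    if u: "u \<in> {1..n}" and v: "v \<in> {1..n}" for u v
  proof -
    have EXX: "measure_pmf.expectation ?R (\<lambda>us. ?X us u * ?X us v)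
      = measure_pmf.prob ?R {us. is_early E us u \<and> is_early E us v}"
    proof -
      have "(\<lambda>us. ?X us u * ?X us v) = indicator {us. is_early E us u \<and> is_early E us v}"
        by (auto simp: indicator_def)
      thus ?thesis by simp
    qed
    have "measure_pmf.expectation ?R (\<lambda>us. (?X us u - ?q u) * (?X us v - ?q v))
      = measure_pmf.expectation ?R
         (\<lambda>us. ?X us u * ?X us v - ?q v * ?X us u - ?q u * ?X us v + ?q u * ?q v)"
      by (rule Bochner_Integration.integral_cong) (simp_all only: algebra_simps)
    also have "\<dots> = measure_pmf.prob ?R {us. is_early E us u \<and> is_early E us v} - ?q u * ?q v"
      by (subst Bochner_Integration.integral_add Bochner_Integration.integral_diff
          Bochner_Integration.integral_mult_right_zero, simp, simp)+
        (simp add: expectation_is_early[OF u] expectation_is_early[OF v] EXX del: One_nat_def)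
    also have "\<dots> \<le> (\<Sum>w\<in>{1..n}. of_bool ({u, w} \<in> E) * of_bool ({v, w} \<in> E)) / 4"
      by (rule covariance_is_early[OF u v])
    finally show ?thesis .
  qed
  have sq: "(early_count n E us - caro_wei n E)\<^sup>2
    = (\<Sum>u\<in>{1..n}. \<Sum>v\<in>{1..n}. (?X us u - ?q u) * (?X us v - ?q v))" for us
    unfolding early_count_def caro_wei_def power2_eq_square sum_subtractf[symmetric]
    by (rule sum_product)
  let ?adj = "\<lambda>u w. of_bool ({u, w} \<in> E) :: real"
  have "measure_pmf.expectation ?R (\<lambda>us. (early_count n E us - caro_wei n E)\<^sup>2)
    = (\<Sum>u\<in>{1..n}. measure_pmf.expectation ?R
        (\<lambda>us. \<Sum>v\<in>{1..n}. (?X us u - ?q u) * (?X us v - ?q v)))"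
    unfolding sq by (rule Bochner_Integration.integral_sum) (rule integrable_random_order, simp)
  also have "\<dots> = (\<Sum>u\<in>{1..n}. \<Sum>v\<in>{1..n}.
      measure_pmf.expectation ?R (\<lambda>us. (?X us u - ?q u) * (?X us v - ?q v)))"
    by (intro sum.cong refl Bochner_Integration.integral_sum integrable_random_order) simp
  also have "\<dots> \<le> (\<Sum>u\<in>{1..n}. \<Sum>v\<in>{1..n}. (\<Sum>w\<in>{1..n}. ?adj u w * ?adj v w) / 4)"
    by (intro sum_mono cov)
  also have "\<dots> = (\<Sum>u\<in>{1..n}. \<Sum>v\<in>{1..n}. \<Sum>w\<in>{1..n}. ?adj u w * ?adj v w) / 4"
    by (simp only: sum_divide_distrib)
  also have "(\<Sum>u\<in>{1..n}. \<Sum>v\<in>{1..n}. \<Sum>w\<in>{1..n}. ?adj u w * ?adj v w)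
      = (\<Sum>u\<in>{1..n}. \<Sum>w\<in>{1..n}. \<Sum>v\<in>{1..n}. ?adj u w * ?adj v w)"
    by (rule sum.cong[OF refl]) (rule sum.swap)
  also have "\<dots> = (\<Sum>w\<in>{1..n}. \<Sum>u\<in>{1..n}. \<Sum>v\<in>{1..n}. ?adj u w * ?adj v w)"
    by (rule sum.swap)
  also have "\<dots> = (\<Sum>w\<in>{1..n}. real (degree E w) * real (degree E w))"
    \<comment> \<open>For fixed \<open>w\<close> the sums over \<open>u\<close> and \<open>v\<close>
      separate, and each equals the degree of \<open>w\<close>.\<close>
    by (simp only: degree_eq_sum sum_product)
  also have "\<dots> \<le> (\<Sum>w\<in>{1..n}. real (max_degree n E) * real (degree E w))"
  proof (intro sum_mono mult_right_mono)
    fix w assume "w \<in> {1..n}"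
    hence "degree E w \<le> max_degree n E"
      unfolding max_degree_def by (intro Max_ge) auto
    thus "real (degree E w) \<le> real (max_degree n E)" by simp
  qed auto
  finally show ?thesis
    by (simp add: sum_distrib_left)
qed

text \<open>The arrival set of a vertex consists of its neighbours in the preceding prefix. It is
  empty exactly when the vertex is the first of its closed neighbourhood, so the algorithm samples
  precisely the early vertices.\<close>

lemma early_count_eq_length:
  assumes us: "us \<in> permutations_of_set {1..n}"
  shows "early_count n E us = real (length (filter (\<lambda>x. snd x = {}) (arrival_stream E us)))"
proof -
  have dist: "distinct us" and set: "set us = {1..n}"
    using permutations_of_setD[OF us] by auto
  have empty_iff: "{us ! j | j. j < i \<and> {us ! i, us ! j} \<in> E} = {} \<longleftrightarrow> is_early E us (us ! i)"
    (is "?A = {} \<longleftrightarrow> _") if i: "i < length us" for i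
  proof -
    let ?N = "closed_nbhd E (us ! i)"
    let ?f = "filter (\<lambda>x. x \<in> ?N)"
    have split: "us = take i us @ us ! i # drop (Suc i) us"
      using i by (rule id_take_nth_drop)
    have notin: "us ! i \<notin> set (take i us)"
      using dist split by (metis distinct_append disjoint_iff list.set_intros(1))
    have "us ! j \<in> set (take i us)" if "j < i" for j
      using that i by (auto simp: in_set_conv_nth intro!: exI[of _ j])
    \<comment> \<open>The list is distinct, so the vertex itself is absent from the prefix; there
      the closed neighbourhood selects only proper neighbours.\<close>
    hence A: "?A = set (?f (take i us))"
      using notin by (fastforce simp: closed_nbhd_def in_set_conv_nth insert_commute)
    have "?f us = ?f (take i us) @ ?f (us ! i # drop (Suc i) us)"
      using split by (metis filter_append)
    hence "?f us = ?f (take i us) @ us ! i # ?f (drop (Suc i) us)"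
      by (simp add: closed_nbhd_def)
    hence "is_early E us (us ! i) \<longleftrightarrow> hd (?f (take i us) @ us ! i # ?f (drop (Suc i) us)) = us ! i"
      by (simp add: is_early_def first_in_def)
    \<comment> \<open>A nonempty filtered prefix would supply a head different from
      \<open>us ! i\<close>.\<close>
    also have "\<dots> \<longleftrightarrow> ?f (take i us) = []"
      using notin hd_in_set[of "?f (take i us)"] by (cases "?f (take i us) = []") auto
    finally show ?thesis
      unfolding A by (simp only: set_empty)
  qed
  have "early_count n E us = (\<Sum>i<length us. of_bool (is_early E us (us ! i)))"
    unfolding early_count_def set[symmetric]
    by (rule sum.reindex_bij_betw[OF bij_betw_nth[OF dist refl refl], symmetric])
  also have "\<dots> = real (card {i. i < length us \<and> is_early E us (us ! i)})"
    by (simp add: sum_of_bool_eq Int_def)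
  also have "{i. i < length us \<and> is_early E us (us ! i)}
    = {i. i < length (arrival_stream E us) \<and> snd (arrival_stream E us ! i) = {}}"
    by (auto simp: arrival_stream_def simp flip: empty_iff)
  finally show ?thesis
    by (simp add: length_filter_conv_card)
qed

end

section \<open>The sampled counter\<close>

lemma expectation_binomial_Suc:
  fixes f :: "nat \<Rightarrow> real"
  assumes p: "p \<in> {0..1}"
  shows "measure_pmf.expectation (binomial_pmf (Suc k) p) f
    = p * measure_pmf.expectation (binomial_pmf k p) (\<lambda>j. f (Suc j))
      + (1 - p) * measure_pmf.expectation (binomial_pmf k p) f"
  unfolding binomial_pmf_Suc[OF p] map_pmf_def[symmetric]
  using p by (subst pmf_expectation_bind[of UNIV]) (auto simp: UNIV_bool intro!: finite_imageI finite_set_pmf_binomial_pmf)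

text \<open>Variance plus squared bias about a centre \<open>a\<close>. The centre is arbitrary
  because a successful coin shifts it to \<open>a - 1\<close> in the induction.\<close>

lemma binomial_second_moment:
  assumes p: "p \<in> {0..1}"
  shows "measure_pmf.expectation (binomial_pmf k p) (\<lambda>j. (real j - a)\<^sup>2)
    = real k * p * (1 - p) + (real k * p - a)\<^sup>2"
proof (induction k arbitrary: a)
  case 0
  show ?case by (simp add: binomial_pmf_0[OF p])
next
  case (Suc k)
  have shift: "measure_pmf.expectation (binomial_pmf k p) (\<lambda>j. (real (Suc j) - a)\<^sup>2)
    = measure_pmf.expectation (binomial_pmf k p) (\<lambda>j. (real j - (a - 1))\<^sup>2)"
    by (rule Bochner_Integration.integral_cong) (simp_all add: algebra_simps)
  show ?case
    unfolding expectation_binomial_Suc[OF p] shift Suc.IH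
    by (simp add: power2_eq_square algebra_simps)
qed

text \<open>The memory state that corresponds to an unbounded counter with value \<open>c\<close>,
  where \<open>T\<close> is the abort threshold.\<close>

definition cap :: "real \<Rightarrow> nat \<Rightarrow> nat option" where
  "cap T c = (if real c > T then None else Some c)"

context
  fixes n :: nat and d \<epsilon> :: real
  assumes n: "n \<ge> 1" and d: "d \<ge> 0" and \<epsilon>: "\<epsilon> > 0"
begin

lemma rate_pos: "cwei3_rate n d \<epsilon> > 0" and rate_le_1: "cwei3_rate n d \<epsilon> \<le> 1"
  using n d \<epsilon> by (auto simp: cwei3_rate_def)

lemma rate_in: "cwei3_rate n d \<epsilon> \<in> {0..1}"
  using rate_pos rate_le_1 by auto

lemma run_from_None: "run_from (cwei3 n d \<epsilon>) None xs = return_pmf None"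
  by (induction xs) (auto simp: cwei3_def Let_def bind_return_pmf split: prod.splits)

text \<open>The counter never decreases, so aborting once the threshold is passed has the same
  effect as counting without a limit and applying \<open>cap\<close> at the end. The unlimited
  counter grows by one coin per empty arrival set, which makes its increment binomial.\<close>

lemma run_from_cap:
  "run_from (cwei3 n d \<epsilon>) (cap (10 * cwei3_rate n d \<epsilon> * real n) c) xs
    = map_pmf (\<lambda>j. cap (10 * cwei3_rate n d \<epsilon> * real n) (c + j))
        (binomial_pmf (length (filter (\<lambda>x. snd x = {}) xs)) (cwei3_rate n d \<epsilon>))"
proof (induction xs arbitrary: c)
  case Nil
  show ?case
    by (simp add: binomial_pmf_0[OF rate_in])
next
  case (Cons x xs)
  let ?A = "cwei3 n d \<epsilon>" and ?p = "cwei3_rate n d \<epsilon>"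
  let ?T = "10 * ?p * real n"
  show ?case
  proof (cases "real c > ?T")
    case True
    hence "cap ?T (c + j) = None" for j
      by (simp add: cap_def)
    thus ?thesis
      using run_from_None[of "x # xs"] True by (simp add: cap_def map_pmf_const)
  next
    case c: False
    obtain u B where x: "x = (u, B)" by force
    show ?thesis
    proof (cases "B = {}")
      case False
      thus ?thesis
        using Cons.IH[of c] c by (simp add: x cap_def cwei3_def Let_def bind_return_pmf)
    next
      case True
      have "step ?A x (cap ?T c)
        = map_pmf (\<lambda>b. cap ?T (c + (if b then 1 else 0))) (bernoulli_pmf ?p)"
        using c True by (auto simp: x cap_def cwei3_def Let_def intro!: map_pmf_cong)
      hence "run_from ?A (cap ?T c) (x # xs)
        = bind_pmf (bernoulli_pmf ?p) (\<lambda>b. run_from ?A (cap ?T (c + (if b then 1 else 0))) xs)"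
        by (simp add: bind_map_pmf)
      also have "\<dots> = bind_pmf (bernoulli_pmf ?p) (\<lambda>b. map_pmf (\<lambda>j. cap ?T (c + (if b then 1 else 0) + j))
          (binomial_pmf (length (filter (\<lambda>x. snd x = {}) xs)) ?p))"
        by (simp only: Cons.IH)
      also have "\<dots> = map_pmf (\<lambda>j. cap ?T (c + j))
          (binomial_pmf (Suc (length (filter (\<lambda>x. snd x = {}) xs))) ?p)"
        unfolding binomial_pmf_Suc[OF rate_in] map_bind_pmf map_return_pmf
        by (simp add: map_pmf_def add.assoc)
      finally show ?thesis
        using True by (simp add: x)
    qed
  qed
qed

lemma init_cap: "init (cwei3 n d \<epsilon>) = cap (10 * cwei3_rate n d \<epsilon> * real n) 0"
  using rate_pos n by (auto simp: cwei3_def Let_def cap_def mult_less_0_iff)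

lemma run_cwei3:
  "run (cwei3 n d \<epsilon>) xs
    = map_pmf (\<lambda>j. map_option (\<lambda>c. real c / cwei3_rate n d \<epsilon>) (cap (10 * cwei3_rate n d \<epsilon> * real n) j))
        (binomial_pmf (length (filter (\<lambda>x. snd x = {}) xs)) (cwei3_rate n d \<epsilon>))"
proof -
  have "result (cwei3 n d \<epsilon>) = map_option (\<lambda>c. real c / cwei3_rate n d \<epsilon>)"
    by (simp add: cwei3_def Let_def)
  thus ?thesis
    by (simp add: run_def init_cap run_from_cap pmf.map_comp o_def)
qed

text \<open>Reachability ranges over arbitrary lists of items, of any length, so the bound on the
  counter comes from the abort threshold alone.\<close>

lemma reachable_cwei3:
  "reachable (cwei3 n d \<epsilon>) \<subseteq> insert None (Some ` {..nat \<lfloor>10 * cwei3_rate n d \<epsilon> * real n\<rfloor>})"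
  unfolding reachable_def init_cap run_from_cap
  by (auto simp: cap_def le_nat_floor split: if_splits)

text \<open>Chebyshev's inequality, multiplied out to avoid dividing by \<open>\<mu>\<close>. The
  second moment of the estimate about \<open>\<mu>\<close> is split by conditioning on the stream:
  the first term is the sampling variance, the second the deviation of the number of empty arrivals
  from \<open>\<mu>\<close>.\<close>

lemma run_cwei3_accurate:
  assumes \<mu>: "0 \<le> \<mu>" "\<mu> \<le> real n" and \<epsilon>1: "\<epsilon> < 1"
    and fin: "finite (set_pmf U)"
  shows "\<epsilon>\<^sup>2 * \<mu>\<^sup>2 * (1 - measure_pmf.prob (bind_pmf U (run (cwei3 n d \<epsilon>)))
      {Some x | x. (1 - \<epsilon>) * \<mu> \<le> x \<and> x \<le> (1 + \<epsilon>) * \<mu>})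
    \<le> measure_pmf.expectation U (\<lambda>xs. real (length (filter (\<lambda>x. snd x = {}) xs)))
        * (1 - cwei3_rate n d \<epsilon>) / cwei3_rate n d \<epsilon>
      + measure_pmf.expectation U (\<lambda>xs. (real (length (filter (\<lambda>x. snd x = {}) xs)) - \<mu>)\<^sup>2)"
proof -
  let ?p = "cwei3_rate n d \<epsilon>"
  let ?k = "\<lambda>xs :: arrival list. length (filter (\<lambda>x. snd x = {}) xs)"
  define J where "J = bind_pmf U (\<lambda>xs. binomial_pmf (?k xs) ?p)"
  let ?h = "\<lambda>j. map_option (\<lambda>c. real c / ?p) (cap (10 * ?p * real n) j)"
  let ?good = "{Some x | x. (1 - \<epsilon>) * \<mu> \<le> x \<and> x \<le> (1 + \<epsilon>) * \<mu>}"
  have p0: "?p > 0" by (rule rate_pos)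
  have "bind_pmf U (run (cwei3 n d \<epsilon>)) = map_pmf ?h J"
    by (simp add: J_def map_bind_pmf run_cwei3[abs_def])
  hence prob: "measure_pmf.prob (bind_pmf U (run (cwei3 n d \<epsilon>))) ?good = measure_pmf.prob J (?h -` ?good)"
    by simp
  \<comment> \<open>An aborted run has an untruncated estimate above \<open>10 n > (1 + \<epsilon>) \<mu>\<close>,
      so aborting causes no failures beyond those of the plain counter.\<close>
  have good: "j \<in> ?h -` ?good" if "\<bar>real j / ?p - \<mu>\<bar> \<le> \<epsilon> * \<mu>" for j
  proof -
    have "real j / ?p \<le> \<mu> + \<epsilon> * \<mu>"
      using that by linarith
    also have "\<dots> \<le> 10 * real n"
      using \<mu> \<epsilon>1 mult_right_mono[of \<epsilon> 1 \<mu>] by simp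
    finally have "real j \<le> 10 * ?p * real n"
      using p0 by (simp add: field_simps)
    thus ?thesis
      using that by (auto simp: cap_def algebra_simps)
  qed
  have finJ: "finite (set_pmf J)"
    using fin rate_in by (auto simp: J_def)
  have "\<epsilon>\<^sup>2 * \<mu>\<^sup>2 * (1 - measure_pmf.prob J (?h -` ?good)) = \<epsilon>\<^sup>2 * \<mu>\<^sup>2 * measure_pmf.prob J (- (?h -` ?good))"
    using measure_pmf.prob_compl[of "?h -` ?good" J] by (simp add: Compl_eq_Diff_UNIV)
  also have "\<dots> = measure_pmf.expectation J (\<lambda>j. \<epsilon>\<^sup>2 * \<mu>\<^sup>2 * indicator (- (?h -` ?good)) j)"
    by simp
  \<comment> \<open>Outside the good event the squared error is at least
    \<open>\<epsilon>\<^sup>2 * \<mu>\<^sup>2\<close>.\<close>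
  also have "\<dots> \<le> measure_pmf.expectation J (\<lambda>j. (real j / ?p - \<mu>)\<^sup>2)"
  proof (rule integral_mono)
    fix j
    show "\<epsilon>\<^sup>2 * \<mu>\<^sup>2 * indicator (- (?h -` ?good)) j \<le> (real j / ?p - \<mu>)\<^sup>2"
    proof (cases "j \<in> ?h -` ?good")
      case False
      hence "\<epsilon> * \<mu> \<le> \<bar>real j / ?p - \<mu>\<bar>"
        using good by force
      hence "(\<epsilon> * \<mu>)\<^sup>2 \<le> \<bar>real j / ?p - \<mu>\<bar>\<^sup>2"
        using \<mu> \<epsilon> by (intro power_mono) auto
      with False show ?thesis
        by (simp add: power_mult_distrib)
    qed simp
  qed (auto intro: integrable_measure_pmf_finite finJ)
  also have "\<dots> = measure_pmf.expectation U
      (\<lambda>xs. measure_pmf.expectation (binomial_pmf (?k xs) ?p) (\<lambda>j. (real j / ?p - \<mu>)\<^sup>2))"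
    unfolding J_def using fin rate_in
    by (subst pmf_expectation_bind[OF fin _ order_refl]) (auto simp: integral_measure_pmf[OF fin])
  also have "\<dots> = measure_pmf.expectation U
      (\<lambda>xs. (1 - ?p) / ?p * real (?k xs) + (real (?k xs) - \<mu>)\<^sup>2)"
  proof (rule Bochner_Integration.integral_cong[OF refl])
    fix xs
    have "measure_pmf.expectation (binomial_pmf (?k xs) ?p) (\<lambda>j. (real j / ?p - \<mu>)\<^sup>2)
      = measure_pmf.expectation (binomial_pmf (?k xs) ?p) (\<lambda>j. (real j - \<mu> * ?p)\<^sup>2 / ?p\<^sup>2)"
      using p0 by (intro Bochner_Integration.integral_cong)
        (simp_all add: power_divide[symmetric] diff_divide_distrib)
    also have "\<dots> = (real (?k xs) * ?p * (1 - ?p) + (real (?k xs) * ?p - \<mu> * ?p)\<^sup>2) / ?p\<^sup>2"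
      by (simp add: binomial_second_moment[OF rate_in])
    also have "\<dots> = (1 - ?p) / ?p * real (?k xs) + (real (?k xs) - \<mu>)\<^sup>2"
      using p0 by (simp add: field_simps power2_eq_square)
    finally show "measure_pmf.expectation (binomial_pmf (?k xs) ?p) (\<lambda>j. (real j / ?p - \<mu>)\<^sup>2)
      = (1 - ?p) / ?p * real (?k xs) + (real (?k xs) - \<mu>)\<^sup>2" .
  qed
  also have "\<dots> = measure_pmf.expectation U (\<lambda>xs. real (?k xs)) * (1 - ?p) / ?p
      + measure_pmf.expectation U (\<lambda>xs. (real (?k xs) - \<mu>)\<^sup>2)"
    by (subst Bochner_Integration.integral_add) (auto intro: integrable_measure_pmf_finite fin)
  finally show ?thesis
    unfolding prob .
qed

end

section \<open>Space: encoding the reachable states by words of fixed length\<close>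

lemma uses_bitsI:
  fixes A :: "('i, 's, 'o) streaming_alg"
  assumes sub: "reachable A \<subseteq> S" and fin: "finite S" and card: "card S \<le> 2 ^ b"
  shows "uses_bits A b"
proof -
  let ?W = "{w :: bool list. length w = b}"
  have W: "finite ?W" "card ?W = 2 ^ b"
    using finite_lists_length_eq[of "UNIV :: bool set" b] card_lists_length_eq[of "UNIV :: bool set" b]
    by simp_all
  obtain enc where enc: "inj_on enc S" "enc ` S \<subseteq> ?W"
    using card_le_inj[OF fin W(1)] card W(2) by auto
  show ?thesis
    unfolding uses_bits_def
    using enc sub by (intro exI[of _ enc]) (auto intro: inj_on_subset)
qed

text \<open>The states are the counters up to \<open>\<lfloor>?T\<rfloor>\<close> and the abort
  state, so there are at most \<open>?T + 2\<close> of them. The threshold \<open>?T\<close> is at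
  most \<open>40 * ?r\<close>, whatever the value of \<open>n\<close>.\<close>

lemma cwei3_space:
  assumes n: "n \<ge> 1" and d: "d \<ge> 0" and \<epsilon>: "0 < \<epsilon>" "\<epsilon> < 1"
  shows "uses_bits (cwei3 n d \<epsilon>) (nat \<lceil>6 + log 2 ((d + 1) / \<epsilon>\<^sup>2)\<rceil>)"
proof (rule uses_bitsI)
  let ?T = "10 * cwei3_rate n d \<epsilon> * real n"
  let ?S = "insert None (Some ` {..nat \<lfloor>?T\<rfloor>})"
  let ?r = "(d + 1) / \<epsilon>\<^sup>2"
  let ?b = "nat \<lceil>6 + log 2 ?r\<rceil>"
  show "reachable (cwei3 n d \<epsilon>) \<subseteq> ?S"
    by (rule reachable_cwei3) (use assms in auto)
  show "finite ?S" by simp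
  have "\<epsilon>\<^sup>2 \<le> 1"
    using \<epsilon> by (simp add: power_le_one)
  hence r: "?r \<ge> 1"
    using d \<epsilon> by simp
  have "cwei3_rate n d \<epsilon> \<le> 4 * (d + 1) / (\<epsilon>\<^sup>2 * real n)"
    by (simp add: cwei3_rate_def)
  hence "?T \<le> 10 * (4 * (d + 1) / (\<epsilon>\<^sup>2 * real n)) * real n"
    by (intro mult_right_mono mult_left_mono) auto
  also have "\<dots> = 40 * ?r"
    using n by simp
  finally have T: "?T \<le> 40 * ?r" .
  have T0: "?T \<ge> 0"
    using rate_pos[of n d \<epsilon>] assms by simp
  have "card ?S = nat \<lfloor>?T\<rfloor> + 2"
    by (simp add: card_image)
  hence "real (card ?S) \<le> ?T + 2"
    using T0 by simp
  \<comment> \<open>As \<open>?r \<ge> 1\<close>, the left side is at most \<open>42 * ?r\<close>;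
    64 is the next power of two and gives the summand 6 in the exponent.\<close>
  also have "\<dots> \<le> 64 * ?r"
    using T r by linarith
  also have "\<dots> = 2 powr (6 + log 2 ?r)"
    using r by (simp add: powr_add)
  also have "\<dots> \<le> 2 powr real ?b"
    by (rule powr_mono) (auto intro: real_nat_ceiling_ge)
  also have "\<dots> = real (2 ^ ?b)"
    by (simp add: powr_realpow)
  finally show "card ?S \<le> 2 ^ ?b"
    by (simp only: of_nat_le_iff)
qed

section \<open>Convexity bound for the Caro-Wei sum, and the failure probability\<close>

lemma caro_wei_ge:
  assumes "n \<ge> 1"
  shows "real n / (avg_degree n E + 1) \<le> caro_wei n E"
proof -
  let ?D = "avg_degree n E + 1"
  have D: "?D > 0"
    by (simp add: avg_degree_def add_nonneg_pos sum_nonneg)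
  \<comment> \<open>The left side is the tangent to \<open>1 / x\<close> at \<open>D\<close>. With
    \<open>D\<close> the mean of the values \<open>degree E v + 1\<close>, summing the tangents
    gives Jensen's inequality.\<close>
  have tangent: "2 / D - x / D\<^sup>2 \<le> 1 / x" if "x > 0" "D > 0" for x D :: real
  proof -
    have "0 \<le> (x - D)\<^sup>2 / (x * D\<^sup>2)"
      using that by simp
    also have "\<dots> = 1 / x - (2 / D - x / D\<^sup>2)"
      using that by (simp add: field_simps power2_eq_square)
    finally show ?thesis by simp
  qed
  have sum: "(\<Sum>v\<in>{1..n}. real (degree E v) + 1) = real n * ?D"
    using assms by (simp add: sum.distrib avg_degree_def field_simps)
  have "real n / ?D = 2 * real n / ?D - (\<Sum>v\<in>{1..n}. real (degree E v) + 1) / ?D\<^sup>2"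
    unfolding sum using D by (simp add: power2_eq_square)
  also have "\<dots> = (\<Sum>v\<in>{1..n}. 2 / ?D - (real (degree E v) + 1) / ?D\<^sup>2)"
    by (simp add: sum_subtractf sum_divide_distrib)
  also have "\<dots> \<le> caro_wei n E"
    unfolding caro_wei_def
  proof (rule sum_mono)
    show "2 / ?D - (real (degree E v) + 1) / ?D\<^sup>2 \<le> 1 / (real (degree E v) + 1)" for v
      by (rule tangent) (use D in auto)
  qed
  finally show ?thesis .
qed

text \<open>\<open>run_cwei3_accurate\<close> is applied with the Caro-Wei bound, the mean of the
  early count, as \<open>\<mu>\<close>. Sampling and random order both contribute multiples of
  \<open>\<epsilon>\<^sup>2 * \<mu>\<^sup>2\<close>, a factor that cancels.\<close>

lemma cwei3_success:
  assumes n: "n \<ge> 1" and E: "simple_graph n E" and \<epsilon>: "0 < \<epsilon>" "\<epsilon> < 1"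
    and \<Delta>: "real (max_degree n E) \<le> \<epsilon>\<^sup>2 * real n / (3 * (avg_degree n E + 1) ^ 3)"
  shows "measure_pmf.prob
      (bind_pmf (random_order_stream n E) (run (cwei3 n (avg_degree n E) \<epsilon>)))
      {Some x | x. (1 - \<epsilon>) * caro_wei n E \<le> x \<and> x \<le> (1 + \<epsilon>) * caro_wei n E} \<ge> 2 / 3"
    (is "?P \<ge> _")
proof -
  let ?d = "avg_degree n E" and ?\<mu> = "caro_wei n E"
  let ?p = "cwei3_rate n ?d \<epsilon>"
  let ?k = "\<lambda>xs :: arrival list. length (filter (\<lambda>x. snd x = {}) xs)"
  have d: "?d \<ge> 0"
    by (simp add: avg_degree_def sum_nonneg)
  have ge: "real n / (?d + 1) \<le> ?\<mu>"
    by (rule caro_wei_ge[OF n])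
  moreover have "real n / (?d + 1) > 0"
    using n d by simp
  ultimately have \<mu>0: "?\<mu> > 0" by linarith
  have "?\<mu> \<le> (\<Sum>v\<in>{1..n}. 1)"
    unfolding caro_wei_def by (rule sum_mono) simp
  hence \<mu>n: "?\<mu> \<le> real n" by simp
  have p: "0 < ?p" "?p \<le> 1"
    using rate_pos rate_le_1 n d \<epsilon> by auto
  have stream: "random_order_stream n E = map_pmf (arrival_stream E) (random_order {1..n})"
    by (simp add: random_order_stream_def random_order_def)
  have count: "measure_pmf.expectation (random_order_stream n E) (\<lambda>xs. f (real (?k xs)))
      = measure_pmf.expectation (random_order {1..n}) (\<lambda>us. f (early_count n E us))"
    for f :: "real \<Rightarrow> real"
    unfolding stream integral_map_pmf
    \<comment> \<open>The two counts are known to agree on permutations of the vertex set, that is,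
      on the support.\<close>
    by (rule integral_cong_AE)
      (auto simp: AE_measure_pmf_iff set_pmf_random_order early_count_eq_length[OF E])
  have "\<epsilon>\<^sup>2 * ?\<mu>\<^sup>2 * (1 - ?P) \<le>
      measure_pmf.expectation (random_order_stream n E) (\<lambda>xs. real (?k xs)) * (1 - ?p) / ?p
      + measure_pmf.expectation (random_order_stream n E) (\<lambda>xs. (real (?k xs) - ?\<mu>)\<^sup>2)"
    using \<mu>0 \<mu>n n d \<epsilon>
    by (intro run_cwei3_accurate) (auto simp: stream set_pmf_random_order)
  also have "\<dots> = ?\<mu> * ((1 - ?p) / ?p)
      + measure_pmf.expectation (random_order {1..n}) (\<lambda>us. (early_count n E us - ?\<mu>)\<^sup>2)"
    using count[of "\<lambda>x. x"] count[of "\<lambda>x. (x - ?\<mu>)\<^sup>2"] expectation_early_count[OF E]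
    by (simp del: One_nat_def)
  also have "\<dots> \<le> \<epsilon>\<^sup>2 * ?\<mu>\<^sup>2 / 4 + \<epsilon>\<^sup>2 * ?\<mu>\<^sup>2 / 12"
  proof (rule add_mono)
    have "(1 - ?p) / ?p \<le> \<epsilon>\<^sup>2 * ?\<mu> / 4"
    \<comment> \<open>At the truncated rate every empty arrival is counted and there is no sampling
      variance; otherwise \<open>1 / ?p\<close> is explicit and \<open>caro_wei_ge\<close> bounds
      it.\<close>
    proof (cases "?p = 1")
      case True
      thus ?thesis using \<mu>0 by simp
    next
      case False
      hence p_eq: "?p = 4 * (?d + 1) / (\<epsilon>\<^sup>2 * real n)"
        by (auto simp: cwei3_rate_def min_def split: if_splits)
      have "(1 - ?p) / ?p \<le> 1 / ?p"
        using p by (simp add: divide_right_mono)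
      also have "\<dots> = \<epsilon>\<^sup>2 / 4 * (real n / (?d + 1))"
        by (simp add: p_eq)
      also have "\<dots> \<le> \<epsilon>\<^sup>2 / 4 * ?\<mu>"
        by (intro mult_left_mono ge) simp
      finally show ?thesis by simp
    qed
    hence "?\<mu> * ((1 - ?p) / ?p) \<le> ?\<mu> * (\<epsilon>\<^sup>2 * ?\<mu> / 4)"
      using \<mu>0 by (intro mult_left_mono) auto
    thus "?\<mu> * ((1 - ?p) / ?p) \<le> \<epsilon>\<^sup>2 * ?\<mu>\<^sup>2 / 4"
      by (simp add: power2_eq_square mult_ac)
  next
    let ?\<Delta> = "real (max_degree n E)"
    have "measure_pmf.expectation (random_order {1..n}) (\<lambda>us. (early_count n E us - ?\<mu>)\<^sup>2)
      \<le> ?\<Delta> * (\<Sum>v\<in>{1..n}. real (degree E v)) / 4"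
      by (rule early_count_variance[OF E])
    also have "(\<Sum>v\<in>{1..n}. real (degree E v)) = real n * ?d"
      using n by (simp add: avg_degree_def)
    \<comment> \<open>Raising \<open>?d\<close> to \<open>?d + 1\<close> cancels one factor of the
      cube and leaves the square of \<open>n / (?d + 1)\<close>.\<close>
    also have "?\<Delta> * (real n * ?d) / 4 \<le> \<epsilon>\<^sup>2 * real n / (3 * (?d + 1) ^ 3) * (real n * (?d + 1)) / 4"
      using d by (intro divide_right_mono mult_mono \<Delta>) auto
    also have "\<dots> = \<epsilon>\<^sup>2 * (real n / (?d + 1))\<^sup>2 / 12"
      using d by (simp add: power2_eq_square power3_eq_cube divide_simps)
    also have "\<dots> \<le> \<epsilon>\<^sup>2 * ?\<mu>\<^sup>2 / 12"
      using d by (intro divide_right_mono mult_left_mono power_mono ge) auto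
    finally show "measure_pmf.expectation (random_order {1..n}) (\<lambda>us. (early_count n E us - ?\<mu>)\<^sup>2)
      \<le> \<epsilon>\<^sup>2 * ?\<mu>\<^sup>2 / 12" .
  qed
  finally have "\<epsilon>\<^sup>2 * ?\<mu>\<^sup>2 * (1 - ?P) \<le> \<epsilon>\<^sup>2 * ?\<mu>\<^sup>2 * (1 / 3)"
    by simp
  hence "1 - ?P \<le> 1 / 3"
    using \<mu>0 \<epsilon> by (subst (asm) mult_le_cancel_left_pos) auto
  thus ?thesis by linarith
qed

text \<open>The first space bound also covers average degree 0, where the logarithm of
  \<open>d / \<epsilon>\<^sup>2\<close> is meaningless as a bound. The second is the literal form,
  stated where that logarithm is at least 1 and so can absorb additive constants.\<close>

theorem theorem9:
  "\<exists>C>0. \<forall>(n::nat) (E::nat set set) (\<epsilon>::real).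
     n \<ge> 1 \<longrightarrow> simple_graph n E \<longrightarrow> 0 < \<epsilon> \<longrightarrow> \<epsilon> < 1 \<longrightarrow>
     real (max_degree n E) \<le> \<epsilon>\<^sup>2 * real n / (3 * (avg_degree n E + 1) ^ 3) \<longrightarrow>
       measure_pmf.prob
         (bind_pmf (random_order_stream n E) (run (cwei3 n (avg_degree n E) \<epsilon>)))
         {Some x | x. (1 - \<epsilon>) * caro_wei n E \<le> x \<and> x \<le> (1 + \<epsilon>) * caro_wei n E} \<ge> 19 / 30
     \<and> (\<exists>b. uses_bits (cwei3 n (avg_degree n E) \<epsilon>) b
          \<and> real b \<le> C * (1 + log 2 ((avg_degree n E + 1) / \<epsilon>\<^sup>2))
          \<and> (avg_degree n E \<ge> 1 \<and> avg_degree n E / \<epsilon>\<^sup>2 \<ge> 2 \<longrightarrow>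
               real b \<le> C * log 2 (avg_degree n E / \<epsilon>\<^sup>2)))"
proof (intro exI[of _ "9::real"] conjI allI impI)
  fix n :: nat and E :: "nat set set" and \<epsilon> :: real
  assume n: "n \<ge> 1" and E: "simple_graph n E" and \<epsilon>: "0 < \<epsilon>" "\<epsilon> < 1"
    and \<Delta>: "real (max_degree n E) \<le> \<epsilon>\<^sup>2 * real n / (3 * (avg_degree n E + 1) ^ 3)"
  let ?d = "avg_degree n E"
  show "measure_pmf.prob (bind_pmf (random_order_stream n E) (run (cwei3 n ?d \<epsilon>)))
      {Some x | x. (1 - \<epsilon>) * caro_wei n E \<le> x \<and> x \<le> (1 + \<epsilon>) * caro_wei n E} \<ge> 19 / 30"
    using cwei3_success[OF n E \<epsilon> \<Delta>] by linarith
  have d: "?d \<ge> 0"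
    by (simp add: avg_degree_def sum_nonneg)
  have "\<epsilon>\<^sup>2 \<le> 1"
    using \<epsilon> by (simp add: power_le_one)
  hence r1: "(?d + 1) / \<epsilon>\<^sup>2 \<ge> 1"
    using d \<epsilon> by simp
  define L where "L = log 2 ((?d + 1) / \<epsilon>\<^sup>2)"
  have L0: "L \<ge> 0"
    using r1 by (simp add: L_def)
  have b: "real (nat \<lceil>6 + L\<rceil>) \<le> 7 + L"
    using L0 by linarith
  show "\<exists>b. uses_bits (cwei3 n ?d \<epsilon>) b \<and> real b \<le> 9 * (1 + log 2 ((?d + 1) / \<epsilon>\<^sup>2))
      \<and> (?d \<ge> 1 \<and> ?d / \<epsilon>\<^sup>2 \<ge> 2 \<longrightarrow> real b \<le> 9 * log 2 (?d / \<epsilon>\<^sup>2))"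
    unfolding L_def[symmetric]
  proof (intro exI[of _ "nat \<lceil>6 + L\<rceil>"] conjI impI)
    show "uses_bits (cwei3 n ?d \<epsilon>) (nat \<lceil>6 + L\<rceil>)"
      unfolding L_def by (rule cwei3_space[OF n d \<epsilon>])
    show "real (nat \<lceil>6 + L\<rceil>) \<le> 9 * (1 + L)"
      by (rule order_trans[OF b]) (use L0 in simp)
    assume large: "?d \<ge> 1 \<and> ?d / \<epsilon>\<^sup>2 \<ge> 2"
    define L' where "L' = log 2 (?d / \<epsilon>\<^sup>2)"
    \<comment> \<open>Average degree at least 1 makes the shift from \<open>?d\<close> to
      \<open>?d + 1\<close> cost at most one bit.\<close>
    have "(?d + 1) / \<epsilon>\<^sup>2 \<le> 2 * (?d / \<epsilon>\<^sup>2)"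
      using large \<epsilon> by (simp add: field_simps)
    hence "L \<le> log 2 (2 * (?d / \<epsilon>\<^sup>2))"
      unfolding L_def using r1 by (intro log_mono) auto
    also have "\<dots> = 1 + L'"
      unfolding L'_def using large by (subst log_mult) auto
    finally have "L \<le> 1 + L'" .
    moreover have "L' \<ge> 1"
      unfolding L'_def using large by (subst le_log_iff) auto
    \<comment> \<open>The witness 9 comes from here: \<open>7 + L \<le> 8 + L'\<close> and
      \<open>1 \<le> L'\<close>.\<close>
    ultimately have "real (nat \<lceil>6 + L\<rceil>) \<le> 9 * L'"
      using b by linarith
    thus "real (nat \<lceil>6 + L\<rceil>) \<le> 9 * log 2 (?d / \<epsilon>\<^sup>2)"
      by (simp only: L'_def)
  qed
qed simp

end
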